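(* Every homology $d$-sphere is $d$-stacked.
   Context: Simplicial complexes are finite and contain the empty set as a face. A homology sphere/ball means an $\mathbb{F}$-homology sphere/ball for some field $\mathbb{F}$. An $\mathbb{F}$-homology $d$-sphere is a $d$-dimensional complex in which the link of every face $\sigma$ (including $\emptyset$) has the reduced $\mathbb{F}$-homology of a $(d-\dim(\sigma)-1)$-sphere. An $\mathbb{F}$-homology $d$-ball is a $d$-dimensional $\mathbb{F}$-acyclic complex in which the link of every non-empty face $\sigma$ has the reduced homology of a $(d-\dim(\sigma)-1)$-sphere or of a point, and whose faces with acyclic link form an $\mathbb{F}$-homology $(d-1)$-sphere (its boundary; equivalently the pure subcomplex whose facets are the $(d-1)$-faces lying in exactly one facet). A homology $(d+1)$-ball is $k$-stacked if all its faces of codimension at least $k+1$ (dimension $\le d-k$) lie in its boundary; a homology $d$-sphere is $k$-stacked if it is the boundary of a $k$-stacked homology $(d+1)$-ball. *)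

theory Defs
  imports Main
begin

definition simplicial_complex :: "'v set set \<Rightarrow> bool" where
  "simplicial_complex K \<longleftrightarrow>
     finite K \<and> {} \<in> K \<and> (\<forall>\<sigma>\<in>K. finite \<sigma>) \<and> (\<forall>\<sigma>\<in>K. \<forall>\<tau>. \<tau> \<subseteq> \<sigma> \<longrightarrow> \<tau> \<in> K)"

text \<open>Dimensions and homological degrees are integers, since the empty face has dimension -1.\<close>

definition face_dim :: "'v set \<Rightarrow> int" where
  "face_dim \<sigma> = int (card \<sigma>) - 1"

definition complex_dim :: "'v set set \<Rightarrow> int" where
  "complex_dim K = Max (face_dim ` K)"

definition link :: "'v set set \<Rightarrow> 'v set \<Rightarrow> 'v set set" where
  "link K \<sigma> = {\<tau> \<in> K. \<tau> \<inter> \<sigma> = {} \<and> \<tau> \<union> \<sigma> \<in> K}"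

text \<open>
  Reduced simplicial homology is defined by oriented chains, which avoids choosing an order on the
  vertices. An \<open>i\<close>-chain with coefficients in the field \<open>'f\<close> is a function on oriented
  \<open>i\<close>-simplices, written as lists of distinct vertices, that changes sign under transposition of
  neighbouring entries: \<open>c xs\<close> is the coefficient of the oriented simplex \<open>xs\<close> in the chain. The
  empty list is the unique oriented simplex of dimension -1, so the complex is the augmented one.
\<close>

definition oriented_chains :: "'v set set \<Rightarrow> int \<Rightarrow> ('v list \<Rightarrow> 'f::field) set" where
  "oriented_chains K i =
     {c. (\<forall>xs. c xs \<noteq> 0 \<longrightarrow> distinct xs \<and> set xs \<in> K \<and> face_dim (set xs) = i) \<and>
         (\<forall>xs a b ys. c (xs @ a # b # ys) = - c (xs @ b # a # ys))}"

text \<open>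
  This is the usual operator sending the oriented simplex \<open>[v\<^sub>0, \<dots>, v\<^sub>i]\<close> to the alternating sum,
  with signs \<open>(-1)^j\<close>, of the simplices with \<open>v\<^sub>j\<close> deleted. Any simplex with the face \<open>ws\<close> can be
  oriented as \<open>v # ws\<close>, and \<open>ws\<close> then occurs in its boundary with sign +1; hence
  the coefficient of \<open>ws\<close> in the boundary of \<open>c\<close> is the sum of the \<open>c (v # ws)\<close>.
\<close>

definition boundary_map :: "'v set set \<Rightarrow> ('v list \<Rightarrow> 'f::field) \<Rightarrow> 'v list \<Rightarrow> 'f" where
  "boundary_map K c = (\<lambda>ws. \<Sum>v\<in>\<Union>K. c (v # ws))"

definition cycles :: "'v set set \<Rightarrow> int \<Rightarrow> ('v list \<Rightarrow> 'f::field) set" where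
  "cycles K i = {c \<in> oriented_chains K i. boundary_map K c = (\<lambda>_. 0)}"

definition boundaries :: "'v set set \<Rightarrow> int \<Rightarrow> ('v list \<Rightarrow> 'f::field) set" where
  "boundaries K i = boundary_map K ` oriented_chains K (i + 1)"

definition homology_class ::
    "'v set set \<Rightarrow> int \<Rightarrow> ('v list \<Rightarrow> 'f::field) \<Rightarrow> ('v list \<Rightarrow> 'f) set" where
  "homology_class K i c = {c' \<in> cycles K i. (\<lambda>xs. c' xs - c xs) \<in> boundaries K i}"

definition reduced_homology :: "'v set set \<Rightarrow> int \<Rightarrow> ('v list \<Rightarrow> 'f::field) set set" where
  "reduced_homology K i = homology_class K i ` cycles K i"

definition homology_vanishes :: "'f::field itself \<Rightarrow> 'v set set \<Rightarrow> int \<Rightarrow> bool" where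
  "homology_vanishes F K i \<longleftrightarrow>
     (reduced_homology K i :: ('v list \<Rightarrow> 'f) set set) = {homology_class K i (\<lambda>_. 0)}"

text \<open>The reduced homology in degree \<open>i\<close> is isomorphic, as a vector space, to the field itself.\<close>

definition homology_iso_field :: "'f::field itself \<Rightarrow> 'v set set \<Rightarrow> int \<Rightarrow> bool" where
  "homology_iso_field F K i \<longleftrightarrow>
     (\<exists>\<phi> :: ('v list \<Rightarrow> 'f) set \<Rightarrow> 'f.
        bij_betw \<phi> (reduced_homology K i) UNIV \<and>
        (\<forall>c\<in>cycles K i. \<forall>c'\<in>cycles K i.
           \<phi> (homology_class K i (\<lambda>xs. c xs + c' xs)) =
           \<phi> (homology_class K i c) + \<phi> (homology_class K i c')) \<and>
        (\<forall>a. \<forall>c\<in>cycles K i.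
           \<phi> (homology_class K i (\<lambda>xs. a * c xs)) = a * \<phi> (homology_class K i c)))"

definition has_homology_of_sphere :: "'f::field itself \<Rightarrow> int \<Rightarrow> 'v set set \<Rightarrow> bool" where
  "has_homology_of_sphere F m K \<longleftrightarrow>
     homology_iso_field F K m \<and> (\<forall>i. i \<noteq> m \<longrightarrow> homology_vanishes F K i)"

text \<open>Equivalently, the complex has the reduced homology of a point.\<close>

definition acyclic_complex :: "'f::field itself \<Rightarrow> 'v set set \<Rightarrow> bool" where
  "acyclic_complex F K \<longleftrightarrow> (\<forall>i. homology_vanishes F K i)"

definition homology_sphere :: "'f::field itself \<Rightarrow> int \<Rightarrow> 'v set set \<Rightarrow> bool" where
  "homology_sphere F d S \<longleftrightarrow>
     simplicial_complex S \<and> complex_dim S = d \<and>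
     (\<forall>\<sigma>\<in>S. has_homology_of_sphere F (d - face_dim \<sigma> - 1) (link S \<sigma>))"

definition ball_boundary :: "'f::field itself \<Rightarrow> 'v set set \<Rightarrow> 'v set set" where
  "ball_boundary F B = {\<sigma> \<in> B. acyclic_complex F (link B \<sigma>)}"

definition homology_ball :: "'f::field itself \<Rightarrow> int \<Rightarrow> 'v set set \<Rightarrow> bool" where
  "homology_ball F d B \<longleftrightarrow>
     simplicial_complex B \<and> complex_dim B = d \<and> acyclic_complex F B \<and>
     (\<forall>\<sigma>\<in>B. \<sigma> \<noteq> {} \<longrightarrow>
        has_homology_of_sphere F (d - face_dim \<sigma> - 1) (link B \<sigma>) \<or>
        acyclic_complex F (link B \<sigma>)) \<and>
     homology_sphere F (d - 1) (ball_boundary F B)"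

text \<open>In a ball of dimension \<open>e = d + 1\<close> the condition on \<open>\<sigma>\<close> reads \<open>face_dim \<sigma> \<le> d - k\<close>.\<close>

definition stacked_ball :: "'f::field itself \<Rightarrow> nat \<Rightarrow> int \<Rightarrow> 'v set set \<Rightarrow> bool" where
  "stacked_ball F k e B \<longleftrightarrow>
     homology_ball F e B \<and>
     (\<forall>\<sigma>\<in>B. e - face_dim \<sigma> \<ge> int k + 1 \<longrightarrow> \<sigma> \<in> ball_boundary F B)"

text \<open>
  The ball is taken over the same field and the same vertex type as the sphere. For \<open>k \<le> d\<close> the
  vertex type is no restriction: all vertices of the ball then lie in its boundary.
\<close>

definition stacked_sphere :: "'f::field itself \<Rightarrow> nat \<Rightarrow> int \<Rightarrow> 'v set set \<Rightarrow> bool" where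
  "stacked_sphere F k d S \<longleftrightarrow>
     homology_sphere F d S \<and> (\<exists>B. stacked_ball F k (d + 1) B \<and> ball_boundary F B = S)"

end

(* Let x be a vertex of the sphere S and let A be its antistar, the faces not containing x. The cone
   B = x * A is the required ball. Links in B of faces without x are cones, hence acyclic; the link of
   t with x added is the antistar of x in link S t, or link S t itself if t and x do not span a face
   of S. So boundary B = S, and the vertices of B are vertices of S, once it is known that the
   antistar of a vertex in a homology sphere L is acyclic. For this, a cycle of the antistar bounds
   a chain b in L; the part of b around x is a cycle in the link of x, which bounds there after
   subtracting a multiple of the fundamental cycle of L from b, so b can be pushed off x. This uses
   that the fundamental cycle does not vanish around any vertex. *)

theory Submission
  imports Defs
begin

section \<open>Oriented chains\<close>

lemma oriented_chainsI:
  assumes "\<And>xs. c xs \<noteq> 0 \<Longrightarrow> distinct xs \<and> set xs \<in> K \<and> face_dim (set xs) = i"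
    and "\<And>xs a b ys. c (xs @ a # b # ys) = - c (xs @ b # a # ys)"
  shows "c \<in> oriented_chains K i"
  using assms unfolding oriented_chains_def by blast

lemma chain_support:
  assumes "c \<in> oriented_chains K i" "c xs \<noteq> 0"
  shows "distinct xs" "set xs \<in> K" "face_dim (set xs) = i"
  using assms unfolding oriented_chains_def by blast+

lemma chain_swap:
  assumes "c \<in> oriented_chains K i"
  shows "c (xs @ a # b # ys) = - c (xs @ b # a # ys)"
  using assms unfolding oriented_chains_def by blast

lemma chain_swap_front:
  assumes "c \<in> oriented_chains K i"
  shows "c (a # b # ys) = - c (b # a # ys)"
  using chain_swap[OF assms, of "[]" a b ys] by simp

text \<open>Each transposition past an entry of \<open>as\<close> costs one sign. Identities between
  alternating functions then need checking only on lists that begin with \<open>x\<close>.\<close>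

lemma swap_to_front:
  fixes f :: "'v list \<Rightarrow> 'f::field"
  assumes "\<And>xs a b ys. f (xs @ a # b # ys) = - f (xs @ b # a # ys)"
  shows "f (as @ x # bs) = (- 1) ^ length as * f (x # as @ bs)"
proof (induction as arbitrary: bs rule: rev_induct)
  case (snoc a as)
  have "f ((as @ [a]) @ x # bs) = - f (as @ x # a # bs)"
    using assms[of as a x bs] by simp
  then show ?case using snoc[of "a # bs"] by simp
qed simp

lemma zero_chain [simp]: "(\<lambda>_. 0) \<in> oriented_chains K i"
  by (simp add: oriented_chains_def)

lemma chain_lincomb:
  fixes b c :: "'v list \<Rightarrow> 'f::field"
  assumes b: "b \<in> oriented_chains K i" and c: "c \<in> oriented_chains K i"
  shows "(\<lambda>xs. b xs - a * c xs) \<in> oriented_chains K i"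
proof (rule oriented_chainsI)
  fix xs assume "b xs - a * c xs \<noteq> 0"
  then have "b xs \<noteq> 0 \<or> c xs \<noteq> 0" by auto
  then show "distinct xs \<and> set xs \<in> K \<and> face_dim (set xs) = i"
    using chain_support[OF b] chain_support[OF c] by blast
next
  fix xs y z ys
  show "b (xs @ y # z # ys) - a * c (xs @ y # z # ys)
      = - (b (xs @ z # y # ys) - a * c (xs @ z # y # ys))"
    using chain_swap[OF b, of xs y z ys] chain_swap[OF c, of xs y z ys] by simp
qed

lemma chain_add:
  fixes b c :: "'v list \<Rightarrow> 'f::field"
  assumes "b \<in> oriented_chains K i" "c \<in> oriented_chains K i"
  shows "(\<lambda>xs. b xs + c xs) \<in> oriented_chains K i"
  using chain_lincomb[OF assms, of "- 1"] by simp

lemma chain_mono: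
  assumes "c \<in> oriented_chains K i" "K \<subseteq> L"
  shows "c \<in> oriented_chains L i"
  using assms unfolding oriented_chains_def by blast

lemma chain_zero_above_dim:
  assumes "c \<in> oriented_chains K i" "\<And>\<sigma>. \<sigma> \<in> K \<Longrightarrow> face_dim \<sigma> < i"
  shows "c = (\<lambda>_. 0)"
proof
  fix xs show "c xs = 0"
    using chain_support[OF assms(1)] assms(2) by force
qed

lemma finite_vertices: "simplicial_complex K \<Longrightarrow> finite (\<Union>K)"
  unfolding simplicial_complex_def by blast

lemma face_subset: "simplicial_complex K \<Longrightarrow> \<sigma> \<in> K \<Longrightarrow> \<tau> \<subseteq> \<sigma> \<Longrightarrow> \<tau> \<in> K"
  unfolding simplicial_complex_def by blast

lemma face_finite: "simplicial_complex K \<Longrightarrow> \<sigma> \<in> K \<Longrightarrow> finite \<sigma>"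
  unfolding simplicial_complex_def by blast

text \<open>\<open>boundary_map\<close> sums over the vertices of its own complex, and coefficients
  at other vertices vanish by the support condition. A common vertex set \<open>V\<close> makes the
  boundary maps of a complex and its subcomplexes comparable.\<close>

lemma boundary_map_eq:
  assumes "c \<in> oriented_chains K i" "finite V" "\<Union>K \<subseteq> V"
  shows "boundary_map K c ws = (\<Sum>v\<in>V. c (v # ws))"
  unfolding boundary_map_def
proof (rule sum.mono_neutral_left)
  show "\<forall>v\<in>V - \<Union>K. c (v # ws) = 0"
  proof
    fix v assume "v \<in> V - \<Union>K"
    then show "c (v # ws) = 0"
      using chain_support(2)[OF assms(1), of "v # ws"] by auto
  qed
qed (use assms in auto)

lemma boundary_map_lincomb:
  "boundary_map K (\<lambda>xs. b xs - a * c xs) =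
    (\<lambda>ws. boundary_map K b ws - a * boundary_map K c ws)"
  unfolding boundary_map_def by (simp add: sum_subtractf sum_distrib_left)

lemma boundary_map_zero [simp]: "boundary_map K (\<lambda>_. 0) = (\<lambda>_. 0)"
  unfolding boundary_map_def by simp

lemma zero_cycle [simp]: "(\<lambda>_. 0) \<in> cycles K i"
  by (simp add: cycles_def)

lemma zero_boundary [simp]: "(\<lambda>_. 0) \<in> boundaries K i"
  unfolding boundaries_def by (rule image_eqI[of _ _ "\<lambda>_. 0"]) simp_all

lemma cycles_chain: "c \<in> cycles K i \<Longrightarrow> c \<in> oriented_chains K i"
  by (simp add: cycles_def)

lemma cycle_sum_zero:
  assumes "c \<in> cycles K i" "finite V" "\<Union>K \<subseteq> V"
  shows "(\<Sum>v\<in>V. c (v # ws)) = 0"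
  using assms boundary_map_eq[OF cycles_chain[OF assms(1)] assms(2,3), of ws]
  by (simp add: cycles_def)

lemma cyclesI:
  assumes "c \<in> oriented_chains K i" "finite V" "\<Union>K \<subseteq> V" "\<And>ws. (\<Sum>v\<in>V. c (v # ws)) = 0"
  shows "c \<in> cycles K i"
  using assms boundary_map_eq[OF assms(1-3)] by (auto simp: cycles_def)

lemma cycle_lincomb:
  "b \<in> cycles K i \<Longrightarrow> c \<in> cycles K i \<Longrightarrow> (\<lambda>xs. b xs - a * c xs) \<in> cycles K i"
  by (simp add: cycles_def chain_lincomb boundary_map_lincomb)

lemma boundaries_lincomb:
  fixes b c :: "'v list \<Rightarrow> 'f::field"
  assumes "b \<in> boundaries K i" "c \<in> boundaries K i"
  shows "(\<lambda>xs. b xs - a * c xs) \<in> boundaries K i"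
proof -
  obtain b' c' where "b' \<in> oriented_chains K (i + 1)" "b = boundary_map K b'"
    "c' \<in> oriented_chains K (i + 1)" "c = boundary_map K c'"
    using assms unfolding boundaries_def by blast
  then show ?thesis
    unfolding boundaries_def
    by (intro image_eqI[of _ _ "\<lambda>xs. b' xs - a * c' xs"])
      (simp_all add: boundary_map_lincomb chain_lincomb)
qed

text \<open>There are no nonzero chains above the dimension, so in top degree homologous cycles are
  equal as functions.\<close>

lemma boundary_zero_top_dim:
  assumes "c \<in> boundaries K i" "\<And>\<sigma>. \<sigma> \<in> K \<Longrightarrow> face_dim \<sigma> \<le> i"
  shows "c = (\<lambda>_. 0)"
proof -
  obtain b where b: "b \<in> oriented_chains K (i + 1)" "c = boundary_map K b"
    using assms unfolding boundaries_def by blast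
  have "b = (\<lambda>_. 0)"
    using chain_zero_above_dim[OF b(1)] assms(2) by (metis zle_add1_eq_le)
  then show ?thesis using b by simp
qed

section \<open>Homology classes as cycles modulo boundaries\<close>

lemma homology_class_refl: "c \<in> cycles K i \<Longrightarrow> c \<in> homology_class K i c"
  by (simp add: homology_class_def)

lemma homology_class_eq_iff:
  fixes c c' :: "'v list \<Rightarrow> 'f::field"
  assumes "c \<in> cycles K i" "c' \<in> cycles K i"
  shows "homology_class K i c = homology_class K i c' \<longleftrightarrow> (\<lambda>xs. c xs - c' xs) \<in> boundaries K i"
proof
  assume "homology_class K i c = homology_class K i c'"
  then show "(\<lambda>xs. c xs - c' xs) \<in> boundaries K i"
    using homology_class_refl[OF assms(1)] by (auto simp: homology_class_def)
next
  assume d: "(\<lambda>xs. c xs - c' xs) \<in> boundaries K i"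
  have "(\<lambda>xs. e xs - c' xs) \<in> boundaries K i" if "(\<lambda>xs. e xs - c xs) \<in> boundaries K i" for e
    using boundaries_lincomb[OF that d, of "- 1"] by simp
  moreover have "(\<lambda>xs. e xs - c xs) \<in> boundaries K i" if "(\<lambda>xs. e xs - c' xs) \<in> boundaries K i" for e
    using boundaries_lincomb[OF that d, of 1] by simp
  ultimately show "homology_class K i c = homology_class K i c'"
    by (auto simp: homology_class_def)
qed

lemma homology_vanishes_iff:
  "homology_vanishes (F :: 'f::field itself) K i \<longleftrightarrow>
    (\<forall>c :: 'v list \<Rightarrow> 'f. c \<in> cycles K i \<longrightarrow> c \<in> boundaries K i)"
proof -
  have "homology_vanishes F K i \<longleftrightarrow>
    (\<forall>c :: 'v list \<Rightarrow> 'f. c \<in> cycles K i \<longrightarrow> homology_class K i c = homology_class K i (\<lambda>_. 0))"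
    unfolding homology_vanishes_def reduced_homology_def
    using zero_cycle[of K i] by blast
  moreover have "homology_class K i c = homology_class K i (\<lambda>_. 0) \<longleftrightarrow> c \<in> boundaries K i"
    if "c \<in> cycles K i" for c :: "'v list \<Rightarrow> 'f"
    using homology_class_eq_iff[OF that zero_cycle] by simp
  ultimately show ?thesis by blast
qed

text \<open>The generator \<open>z\<close> is a cycle whose class \<open>\<phi>\<close> sends to 1;
  injectivity of \<open>\<phi>\<close> makes every cycle homologous to a multiple of it. The zero
  class goes to 0 by scaling, so \<open>z\<close> is not a boundary.\<close>

lemma homology_iso_fieldE:
  fixes F :: "'f::field itself" and K :: "'v set set"
  assumes "homology_iso_field F K i"
  obtains z :: "'v list \<Rightarrow> 'f" where "z \<in> cycles K i" "z \<notin> boundaries K i"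
    "\<And>z'. z' \<in> cycles K i \<Longrightarrow> \<exists>a. (\<lambda>xs. z' xs - a * z xs) \<in> boundaries K i"
proof -
  obtain \<phi> :: "('v list \<Rightarrow> 'f) set \<Rightarrow> 'f" where
    bij: "bij_betw \<phi> (reduced_homology K i) UNIV" and
    scale: "\<And>a c. c \<in> cycles K i \<Longrightarrow>
      \<phi> (homology_class K i (\<lambda>xs. a * c xs)) = a * \<phi> (homology_class K i c)"
    using assms unfolding homology_iso_field_def by blast
  have inj: "homology_class K i c = homology_class K i c'"
    if "c \<in> cycles K i" "c' \<in> cycles K i" "\<phi> (homology_class K i c) = \<phi> (homology_class K i c')"
    for c c' :: "'v list \<Rightarrow> 'f"
    using that bij unfolding bij_betw_def inj_on_def reduced_homology_def by blast
  have "1 \<in> \<phi> ` reduced_homology K i"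
    using bij by (simp add: bij_betw_def)
  then obtain z where z: "z \<in> cycles K i" "\<phi> (homology_class K i z) = 1"
    unfolding reduced_homology_def by force
  have sz: "(\<lambda>xs. a * z xs) \<in> cycles K i" for a
    using cycle_lincomb[OF zero_cycle z(1), of "- a"] by simp
  show ?thesis
  proof
    show "z \<in> cycles K i" by fact
    show "z \<notin> boundaries K i"
    proof
      assume "z \<in> boundaries K i"
      then have "homology_class K i z = homology_class K i (\<lambda>_. 0)"
        using homology_class_eq_iff[OF z(1) zero_cycle] by simp
      then show False
        using z(2) scale[OF z(1), of 0] by simp
    qed
    fix z' :: "'v list \<Rightarrow> 'f" assume z': "z' \<in> cycles K i"
    define a where "a = \<phi> (homology_class K i z')"
    have "homology_class K i z' = homology_class K i (\<lambda>xs. a * z xs)"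
      using inj[OF z' sz, of a] scale[OF z(1), of a] z(2) by (simp add: a_def)
    then show "\<exists>a. (\<lambda>xs. z' xs - a * z xs) \<in> boundaries K i"
      using homology_class_eq_iff[OF z' sz] by blast
  qed
qed

lemma sphere_not_acyclic:
  fixes F :: "'f::field itself"
  shows "has_homology_of_sphere F m K \<Longrightarrow> \<not> acyclic_complex F K"
  unfolding has_homology_of_sphere_def acyclic_complex_def
  by (metis homology_iso_fieldE homology_vanishes_iff)

section \<open>Cones\<close>

text \<open>The join of \<open>x\<close> with \<open>c\<close>: the recursion moves the first
  \<open>x\<close> to the front, one sign per entry passed, and evaluates \<open>c\<close> on the
  remaining entries. A second \<open>x\<close> gives 0, so simplices of \<open>c\<close> through
  \<open>x\<close> contribute nothing.\<close>

fun cone_chain :: "'v \<Rightarrow> ('v list \<Rightarrow> 'f::field) \<Rightarrow> 'v list \<Rightarrow> 'f" where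
  "cone_chain x c [] = 0"
| "cone_chain x c (v # vs) =
    (if v = x then if x \<in> set vs then 0 else c vs
     else - cone_chain x (\<lambda>ws. c (v # ws)) vs)"

lemma cone_chain_uminus: "cone_chain x (\<lambda>ws. - c ws) xs = - cone_chain x c xs"
  by (induction xs arbitrary: c) auto

lemma cone_chain_swap:
  assumes "\<And>xs a b ys. c (xs @ a # b # ys) = - c (xs @ b # a # ys)"
  shows "cone_chain x c (xs @ a # b # ys) = - cone_chain x c (xs @ b # a # ys)"
  using assms
proof (induction xs arbitrary: c)
  case Nil
  \<comment> \<open>If neither \<open>a\<close> nor \<open>b\<close> is \<open>x\<close>, the sign
    comes from \<open>c\<close>; if exactly one is, it comes from the recursion; if both are, both
    values are 0.\<close>
  have "(\<lambda>ws. c (a # b # ws)) = (\<lambda>ws. - c (b # a # ws))"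
    using Nil[of "[]" a b] by auto
  then show ?case by (auto simp: cone_chain_uminus)
next
  case (Cons v xs)
  have "cone_chain x (\<lambda>ws. c (v # ws)) (xs @ a # b # ys) =
    - cone_chain x (\<lambda>ws. c (v # ws)) (xs @ b # a # ys)"
  proof (rule Cons.IH)
    show "c (v # ys @ y # z # zs) = - c (v # ys @ z # y # zs)" for ys y z zs
      using Cons.prems[of "v # ys" y z zs] by simp
  qed
  then show ?case using Cons.prems[of xs a b ys] by auto
qed

lemma cone_chain_support:
  assumes "cone_chain x c xs \<noteq> 0"
  shows "\<exists>ys. c ys \<noteq> 0 \<and> set xs = insert x (set ys) \<and> length xs = Suc (length ys) \<and> x \<notin> set ys"
  using assms
proof (induction xs arbitrary: c)
  case (Cons v vs)
  show ?case
  proof (cases "v = x")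
    case True
    then show ?thesis using Cons.prems by (intro exI[of _ vs]) (auto split: if_splits)
  next
    case False
    then obtain ys where "c (v # ys) \<noteq> 0" "set vs = insert x (set ys)"
      "length vs = Suc (length ys)" "x \<notin> set ys"
      using Cons.IH[of "\<lambda>ws. c (v # ws)"] Cons.prems by auto
    then show ?thesis using False by (intro exI[of _ "v # ys"]) auto
  qed
qed simp

lemma cone_chain_in_chains:
  assumes c: "c \<in> oriented_chains K i" and cone: "\<And>\<sigma>. \<sigma> \<in> K \<Longrightarrow> insert x \<sigma> \<in> K"
  shows "cone_chain x c \<in> oriented_chains K (i + 1)"
proof (rule oriented_chainsI)
  fix xs assume nz: "cone_chain x c xs \<noteq> 0"
  obtain ys where ys: "c ys \<noteq> 0" "set xs = insert x (set ys)"
      "length xs = Suc (length ys)" "x \<notin> set ys"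
    using cone_chain_support[OF nz] by blast
  note s = chain_support[OF c ys(1)]
  have cd: "card (set xs) = Suc (card (set ys))" using ys by simp
  then have "distinct xs" using ys(3) s(1) distinct_card[of ys] by (intro card_distinct) simp
  then show "distinct xs \<and> set xs \<in> K \<and> face_dim (set xs) = i + 1"
    using s cone ys cd by (auto simp: face_dim_def)
qed (rule cone_chain_swap, rule chain_swap[OF c])

text \<open>Coning is a contracting homotopy: the boundary of the cone over \<open>c\<close> is
  \<open>c\<close> minus the cone over the boundary of \<open>c\<close>, hence \<open>c\<close>
  itself for a cycle. This is checked on lists with \<open>x\<close> in front, elsewhere, and
  absent.\<close>

lemma cone_acyclic:
  fixes F :: "'f::field itself"
  assumes K: "simplicial_complex K" and cone: "\<And>\<sigma>. \<sigma> \<in> K \<Longrightarrow> insert x \<sigma> \<in> K"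
  shows "acyclic_complex F K"
  unfolding acyclic_complex_def homology_vanishes_iff
proof (intro allI impI)
  fix i and c :: "'a list \<Rightarrow> 'f" assume cyc: "c \<in> cycles K i"
  note c = cycles_chain[OF cyc]
  let ?V = "\<Union>K" and ?b = "cone_chain x c"
  have V: "finite ?V" using finite_vertices[OF K] .
  have "{x} \<in> K" using K cone[of "{}"] by (simp add: simplicial_complex_def)
  then have xV: "x \<in> ?V" by blast
  have b: "?b \<in> oriented_chains K (i + 1)"
    using cone_chain_in_chains[OF c cone] .
  have swap_front: "boundary_map K ?b (as @ x # bs) = c (as @ x # bs)"
    if eq: "boundary_map K ?b (x # as @ bs) = c (x # as @ bs)" for as bs
  proof -
    have "boundary_map K ?b (xs @ y # z # ys) = - boundary_map K ?b (xs @ z # y # ys)" for xs y z ys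
      using chain_swap[OF b, of "_ # xs" y z ys]
      by (simp add: boundary_map_def sum_negf del: cone_chain.simps)
    then have "boundary_map K ?b (as @ x # bs) = (- 1) ^ length as * boundary_map K ?b (x # as @ bs)"
      by (rule swap_to_front)
    also have "\<dots> = c (as @ x # bs)"
      using swap_to_front[of c as x bs, OF chain_swap[OF c]] eq by simp
    finally show ?thesis .
  qed
  have front: "boundary_map K ?b (x # us) = c (x # us)" for us
  proof (cases "x \<in> set us")
    case True
    then have "c (x # us) = 0" "?b (v # x # us) = 0" for v
      using chain_support(1)[OF c, of "x # us"] chain_support(1)[OF b, of "v # x # us"]
      by auto
    then show ?thesis by (simp add: boundary_map_def del: cone_chain.simps)
  next
    case False
    \<comment> \<open>Moving \<open>x\<close> past \<open>v\<close> gives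
      \<open>- c (v # us)\<close>; by the cycle condition at \<open>us\<close> these terms add up to
      \<open>c (x # us)\<close>.\<close>
    have "boundary_map K ?b (x # us) = (\<Sum>v\<in>?V. - (if v = x then 0 else c (v # us)))"
      unfolding boundary_map_def using False by (intro sum.cong) auto
    also have "\<dots> = - (\<Sum>v\<in>?V - {x}. c (v # us))"
      using V xV by (simp add: sum_negf sum.remove[of ?V x])
    also have "\<dots> = c (x # us)"
    proof -
      have "c (x # us) + (\<Sum>v\<in>?V - {x}. c (v # us)) = 0"
        using cycle_sum_zero[OF cyc V order_refl, of us] sum.remove[OF V xV] by metis
      then show ?thesis by (metis add.commute minus_unique)
    qed
    finally show ?thesis .
  qed
  have "boundary_map K ?b ws = c ws" for ws
  proof (cases "x \<in> set ws")
    case True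
    then obtain as bs where "ws = as @ x # bs" by (meson split_list)
    then show ?thesis using swap_front front by simp
  next
    case False
    have "?b (v # ws) = 0" if "v \<noteq> x" for v
      using cone_chain_support[of x c "v # ws"] that False by force
    then have "boundary_map K ?b ws = (\<Sum>v\<in>?V. if v = x then c ws else 0)"
      unfolding boundary_map_def using False by (intro sum.cong) auto
    then show ?thesis using V xV by simp
  qed
  then show "c \<in> boundaries K i"
    unfolding boundaries_def using b by (intro image_eqI[of _ _ ?b]) auto
qed

section \<open>Links and top-dimensional cycles\<close>

lemma link_empty: "link K {} = K"
  by (auto simp: link_def)

lemma link_complex:
  assumes K: "simplicial_complex K" and s: "\<sigma> \<in> K"
  shows "simplicial_complex (link K \<sigma>)"
proof -
  have "finite (link K \<sigma>)" using K by (auto simp: link_def simplicial_complex_def)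
  moreover have "\<tau> \<in> link K \<sigma>" if "\<rho> \<in> link K \<sigma>" "\<tau> \<subseteq> \<rho>" for \<rho> \<tau>
  proof -
    have "\<tau> \<union> \<sigma> \<subseteq> \<rho> \<union> \<sigma>" using that by blast
    then show ?thesis using that face_subset[OF K] by (auto simp: link_def)
  qed
  moreover have "{} \<in> link K \<sigma>" using K s by (simp add: link_def simplicial_complex_def)
  moreover have "finite \<tau>" if "\<tau> \<in> link K \<sigma>" for \<tau>
    using that face_finite[OF K] by (simp add: link_def)
  ultimately show ?thesis
    unfolding simplicial_complex_def by blast
qed

lemma link_link:
  assumes K: "simplicial_complex K" and "\<tau> \<in> link K \<sigma>"
  shows "link (link K \<sigma>) \<tau> = link K (\<sigma> \<union> \<tau>)"
proof -
  have "\<rho> \<union> \<sigma> \<in> K \<and> \<rho> \<union> \<tau> \<in> K" if "\<rho> \<union> (\<sigma> \<union> \<tau>) \<in> K" for \<rho>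
    using face_subset[OF K that, of "\<rho> \<union> \<sigma>"] face_subset[OF K that, of "\<rho> \<union> \<tau>"] by blast
  then show ?thesis
    using assms by (auto simp: link_def Un_ac Int_Un_distrib Int_Un_distrib2)
qed

text \<open>Only an upper bound on the dimension is required, so that links inherit the property
  without a proof that homology spheres are pure.\<close>

definition local_sphere :: "'f::field itself \<Rightarrow> nat \<Rightarrow> 'v set set \<Rightarrow> bool" where
  "local_sphere F m L \<longleftrightarrow>
     simplicial_complex L \<and> (\<forall>\<sigma>\<in>L. face_dim \<sigma> \<le> int m) \<and>
     (\<forall>\<sigma>\<in>L. has_homology_of_sphere F (int m - face_dim \<sigma> - 1) (link L \<sigma>))"

lemma local_sphereD:
  assumes "local_sphere F m L"
  shows "simplicial_complex L" "\<sigma> \<in> L \<Longrightarrow> face_dim \<sigma> \<le> int m"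
    "\<sigma> \<in> L \<Longrightarrow> has_homology_of_sphere F (int m - face_dim \<sigma> - 1) (link L \<sigma>)"
  using assms unfolding local_sphere_def by blast+

lemma local_sphere_homology:
  assumes "local_sphere F m L"
  shows "has_homology_of_sphere F (int m) L"
  using local_sphereD(1)[OF assms] local_sphereD(3)[OF assms, of "{}"]
  by (simp add: link_empty face_dim_def simplicial_complex_def)

text \<open>Links in a link are links of larger faces, with all dimensions lowered by
  \<open>card \<sigma>\<close>. The form \<open>m = n + card \<sigma>\<close> avoids truncated
  subtraction.\<close>

lemma local_sphere_link:
  assumes L: "local_sphere F m L" and s: "\<sigma> \<in> L" and n: "m = n + card \<sigma>"
  shows "local_sphere F n (link L \<sigma>)"
  unfolding local_sphere_def
proof (intro conjI ballI)
  note K = local_sphereD(1)[OF L]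
  show "simplicial_complex (link L \<sigma>)" using link_complex[OF K s] .
  fix \<tau> assume t: "\<tau> \<in> link L \<sigma>"
  then have u: "\<sigma> \<union> \<tau> \<in> L" by (simp add: link_def Un_commute)
  have fd: "face_dim (\<sigma> \<union> \<tau>) = face_dim \<tau> + int (card \<sigma>)"
    using t face_finite[OF K s] face_finite[OF K, of \<tau>]
    by (simp add: face_dim_def link_def card_Un_disjoint Int_commute)
  then show "face_dim \<tau> \<le> int n"
    using local_sphereD(2)[OF L u] n by simp
  show "has_homology_of_sphere F (int n - face_dim \<tau> - 1) (link (link L \<sigma>) \<tau>)"
    using local_sphereD(3)[OF L u] n fd by (simp add: link_link[OF K t] algebra_simps)
qed

text \<open>Off-diagonal terms cancel in pairs. The diagonal has its own hypothesis because in
  characteristic 2 antisymmetry does not force \<open>f v v = 0\<close>.\<close>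

lemma alternating_sum_zero:
  fixes f :: "'v \<Rightarrow> 'v \<Rightarrow> 'f::field"
  assumes "finite W" "\<And>v w. f v w = - f w v" "\<And>v. f v v = 0"
  shows "(\<Sum>w\<in>W. \<Sum>v\<in>W. f v w) = 0"
  using assms(1)
proof induction
  case (insert a W)
  have "(\<Sum>w\<in>W. f a w) = - (\<Sum>w\<in>W. f w a)"
    by (subst assms(2)) (simp add: sum_negf)
  then show ?case using insert by (simp add: sum.distrib assms(3))
qed simp

section \<open>Connectedness from vanishing reduced homology in degree 0\<close>

definition vertex_difference :: "'v \<Rightarrow> 'v \<Rightarrow> 'v list \<Rightarrow> 'f::field" where
  "vertex_difference u w = (\<lambda>xs. if xs = [u] then 1 else if xs = [w] then - 1 else 0)"

lemma vertex_difference_cycle: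
  assumes K: "simplicial_complex K" and "{u} \<in> K" "{w} \<in> K" "u \<noteq> w"
  shows "(vertex_difference u w :: 'v list \<Rightarrow> 'f::field) \<in> cycles K 0"
proof (rule cyclesI)
  show "(vertex_difference u w :: 'v list \<Rightarrow> 'f) \<in> oriented_chains K 0"
    using assms
    by (intro oriented_chainsI)
      (auto simp: vertex_difference_def face_dim_def append_eq_Cons_conv split: if_splits)
  show "finite (\<Union>K)" using finite_vertices[OF K] .
  fix ws
  show "(\<Sum>v\<in>\<Union>K. vertex_difference u w (v # ws)) = (0 :: 'f)"
  \<comment> \<open>At \<open>[]\<close> the boundary is the augmentation, where the coefficients 1
    and -1 cancel.\<close>
  proof (cases "ws = []")
    case True
    have "(\<Sum>v\<in>\<Union>K. vertex_difference u w [v]) =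
      (\<Sum>v\<in>\<Union>K. (if v = u then 1 else 0) - (if v = w then 1 else (0 :: 'f)))"
      using assms(4) by (intro sum.cong) (auto simp: vertex_difference_def)
    also have "\<dots> = 0"
      using assms finite_vertices[OF K] by (auto simp: sum_subtractf)
    finally show ?thesis using True by simp
  qed (simp add: vertex_difference_def)
qed simp

text \<open>If \<open>y\<close> lies outside the set \<open>W\<close> of vertices with
  \<open>P\<close>, take a 1-chain bounding \<open>x - y\<close>. It has no edge leaving
  \<open>W\<close>, and an edge inside \<open>W\<close> contributes opposite amounts at its ends, so
  the coefficients of \<open>x - y\<close> over \<open>W\<close> sum to 0; but this sum is
  1.\<close>

lemma connected_by_homology:
  fixes F :: "'f::field itself"
  assumes K: "simplicial_complex K" and van: "homology_vanishes F K 0"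
    and x: "{x} \<in> K" "P x"
    and step: "\<And>v w. P v \<Longrightarrow> {v, w} \<in> K \<Longrightarrow> v \<noteq> w \<Longrightarrow> P w"
    and y: "{y} \<in> K"
  shows "P y"
proof (rule ccontr)
  assume ny: "\<not> P y"
  define W where "W = {v \<in> \<Union>K. P v}"
  have W: "W \<subseteq> \<Union>K" "x \<in> W" "y \<notin> W"
    using x ny by (auto simp: W_def)
  have finW: "finite W" using finite_subset[OF W(1) finite_vertices[OF K]] .
  have "x \<noteq> y" using x ny by blast
  then have "(vertex_difference x y :: 'a list \<Rightarrow> 'f) \<in> boundaries K 0"
    using van vertex_difference_cycle[OF K x(1) y] unfolding homology_vanishes_iff by blast
  then obtain c :: "'a list \<Rightarrow> 'f" where
    c: "c \<in> oriented_chains K 1" "vertex_difference x y = boundary_map K c"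
    unfolding boundaries_def by auto
  have inner: "boundary_map K c [w] = (\<Sum>v\<in>W. c [v, w])" if "w \<in> W" for w
    unfolding boundary_map_def
  proof (rule sum.mono_neutral_right)
    show "\<forall>v\<in>\<Union>K - W. c [v, w] = 0"
    proof (intro ballI, rule ccontr)
      fix v assume v: "v \<in> \<Union>K - W" and "c [v, w] \<noteq> 0"
      then have "v \<noteq> w" "{w, v} \<in> K"
        using chain_support[OF c(1), of "[v, w]"] by (auto simp: insert_commute)
      then show False using step[of w v] v that by (auto simp: W_def)
    qed
  qed (use W finite_vertices[OF K] in blast)+
  have "(1 :: 'f) = (\<Sum>w\<in>W. vertex_difference x y [w])"
  proof -
    have "(\<Sum>w\<in>W. vertex_difference x y [w]) = (\<Sum>w\<in>W. if w = x then (1 :: 'f) else 0)"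
      using W by (intro sum.cong) (auto simp: vertex_difference_def)
    then show ?thesis using W finW by simp
  qed
  also have "\<dots> = (\<Sum>w\<in>W. \<Sum>v\<in>W. c [v, w])"
    using inner c(2) by simp
  also have "\<dots> = 0"
    using finW
  proof (rule alternating_sum_zero)
    show "c [v, w] = - c [w, v]" for v w using chain_swap_front[OF c(1), of v w "[]"] .
    show "c [v, v] = 0" for v using chain_support(1)[OF c(1), of "[v, v]"] by auto
  qed
  finally show False by simp
qed

section \<open>Restriction to vertex links, and rigidity of top cycles\<close>

lemma chain_link:
  assumes c: "c \<in> oriented_chains K i" and K: "simplicial_complex K"
  shows "(\<lambda>ws. c (x # ws)) \<in> oriented_chains (link K {x}) (i - 1)"
proof (rule oriented_chainsI)
  fix ws assume "c (x # ws) \<noteq> 0"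
  note s = chain_support[OF c this]
  have "set ws \<in> K" using face_subset[OF K s(2)] by auto
  then show "distinct ws \<and> set ws \<in> link K {x} \<and> face_dim (set ws) = i - 1"
    using s by (auto simp: link_def face_dim_def)
next
  fix xs a b ys
  show "c (x # xs @ a # b # ys) = - c (x # xs @ b # a # ys)"
    using chain_swap[OF c, of "x # xs" a b ys] by simp
qed

text \<open>Exchanging \<open>v\<close> and \<open>x\<close> turns the boundary around
  \<open>x\<close> into minus the boundary of the restricted chain. Vanishing is asked only around
  \<open>x\<close>, so the lemma also covers chains whose boundary avoids \<open>x\<close>.\<close>

lemma link_cycle:
  fixes c :: "'v list \<Rightarrow> 'f::field"
  assumes c: "c \<in> oriented_chains K i" and K: "simplicial_complex K"
    and z: "\<And>ws. boundary_map K c (x # ws) = 0"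
  shows "(\<lambda>ws. c (x # ws)) \<in> cycles (link K {x}) (i - 1)"
proof (rule cyclesI)
  show "(\<lambda>ws. c (x # ws)) \<in> oriented_chains (link K {x}) (i - 1)"
    using chain_link[OF c K] .
  show "finite (\<Union>K)" using finite_vertices[OF K] .
  show "\<Union>(link K {x}) \<subseteq> \<Union>K" by (auto simp: link_def)
  fix ws
  have "(\<Sum>v\<in>\<Union>K. c (x # v # ws)) = (\<Sum>v\<in>\<Union>K. - c (v # x # ws))"
    by (intro sum.cong refl chain_swap_front[OF c])
  then show "(\<Sum>v\<in>\<Union>K. c (x # v # ws)) = 0"
    using z[of ws] by (simp add: boundary_map_def sum_negf)
qed

text \<open>Vanishing in the star of a vertex spreads to the stars of its neighbours by induction in
  their links, and from there to everything because the complex is connected.\<close>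

lemma top_cycle_zero:
  fixes F :: "'f::field itself" and z :: "'v list \<Rightarrow> 'f"
  assumes "local_sphere F m L" "z \<in> cycles L (int m)" "{x} \<in> L" "\<And>ws. z (x # ws) = 0"
  shows "z = (\<lambda>_. 0)"
  using assms
proof (induction m arbitrary: L z x)
  case 0
  note K = local_sphereD(1)[OF 0(1)]
  have bd: "b = (\<lambda>_. 0)" if "b \<in> boundaries L 0" for b :: "'v list \<Rightarrow> 'f"
    using boundary_zero_top_dim[OF that] local_sphereD(2)[OF 0(1)] by simp
  show ?case
  proof (rule ccontr)
    assume "z \<noteq> (\<lambda>_. 0)"
    then obtain xs where xs: "z xs \<noteq> 0" by blast
    note s = chain_support[OF cycles_chain[OF 0(2)] xs]
    then have "length xs = 1" by (simp add: face_dim_def distinct_card)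
    then obtain w where w: "xs = [w]" by (cases xs) auto
    have "w \<noteq> x" using xs w 0(4) by auto
    then have d: "(vertex_difference x w :: 'v list \<Rightarrow> 'f) \<in> cycles L 0"
      using s w by (intro vertex_difference_cycle[OF K 0(3)]) auto
    \<comment> \<open>Degree 0 has no nonzero boundaries here, so \<open>x - w\<close> and
      \<open>z\<close> are multiples of one \<open>g\<close>. The first gives
      \<open>g [x] \<noteq> 0\<close>; since \<open>z [x] = 0\<close>, the multiple for
      \<open>z\<close> is then 0.\<close>
    have "homology_iso_field F L 0"
      using local_sphere_homology[OF 0(1)] by (simp add: has_homology_of_sphere_def)
    then obtain g :: "'v list \<Rightarrow> 'f" where
      g: "\<And>z'. z' \<in> cycles L 0 \<Longrightarrow> \<exists>a. (\<lambda>xs. z' xs - a * g xs) \<in> boundaries L 0"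
      by (rule homology_iso_fieldE) blast
    obtain a where "(\<lambda>xs. vertex_difference x w xs - a * g xs) \<in> boundaries L 0"
      using g[OF d] by blast
    from fun_cong[OF bd[OF this], of "[x]"] have a: "a * g [x] = 1"
      by (simp add: vertex_difference_def)
    obtain a' where "(\<lambda>xs. z xs - a' * g xs) \<in> boundaries L 0"
      using g 0(2) by auto
    note bz = bd[OF this]
    from fun_cong[OF bz, of "[x]"] have "a' * g [x] = 0"
      using 0(4) by simp
    then have "a' = 0" using a by auto
    with fun_cong[OF bz, of "[w]"] xs w show False by simp
  qed
next
  case (Suc n)
  note K = local_sphereD(1)[OF Suc.prems(1)]
  note zc = cycles_chain[OF Suc.prems(2)]
  have dead: "\<forall>ws. z (y # ws) = 0" if y: "{y} \<in> L" for y
  proof (rule connected_by_homology[where K = L and F = F and x = x])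
    \<comment> \<open>The top degree \<open>Suc n\<close> is positive, so degree 0 is a vanishing
      degree.\<close>
    show "homology_vanishes F L 0"
      using local_sphere_homology[OF Suc.prems(1)] by (simp add: has_homology_of_sphere_def)
    fix v w assume v: "\<forall>ws. z (v # ws) = 0" and vw: "{v, w} \<in> L" "v \<noteq> w"
    have w: "{w} \<in> L" and v': "{v} \<in> L" using face_subset[OF K vw(1)] by auto
    \<comment> \<open>The restriction of \<open>z\<close> to the link of \<open>w\<close> is a top
      cycle there, and it vanishes around the vertex \<open>v\<close> of that link by
      antisymmetry.\<close>
    have "(\<lambda>ws. z (w # ws)) = (\<lambda>_. 0)"
    proof (rule Suc.IH)
      show "local_sphere F n (link L {w})"
        using local_sphere_link[OF Suc.prems(1) w] by simp
      show "(\<lambda>ws. z (w # ws)) \<in> cycles (link L {w}) (int n)"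
        using link_cycle[OF zc K, of w] Suc.prems(2) by (simp add: cycles_def)
      show "{v} \<in> link L {w}" using v' vw by (simp add: link_def insert_commute)
      show "z (w # v # ws) = 0" for ws
        using v chain_swap_front[OF zc, of w v ws] by simp
    qed
    then show "\<forall>ws. z (w # ws) = 0" by metis
  qed (use K Suc.prems y in auto)
  show ?case
  proof (rule ext, rule ccontr)
    fix xs assume xs: "z xs \<noteq> 0"
    note s = chain_support[OF zc xs]
    show False
    proof (cases xs)
      case Nil
      then show ?thesis using s by (simp add: face_dim_def)
    next
      case (Cons y ys)
      then have "{y} \<in> L" using face_subset[OF K s(2)] by simp
      then show ?thesis using dead xs Cons by simp
    qed
  qed
qed

section \<open>The antistar of a vertex\<close>

definition antistar :: "'v set set \<Rightarrow> 'v \<Rightarrow> 'v set set" where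
  "antistar K x = {\<sigma> \<in> K. x \<notin> \<sigma>}"

lemma antistar_complex: "simplicial_complex K \<Longrightarrow> simplicial_complex (antistar K x)"
  unfolding simplicial_complex_def antistar_def by auto

lemma link_antistar: "x \<notin> \<tau> \<Longrightarrow> link (antistar K x) \<tau> = antistar (link K \<tau>) x"
  by (auto simp: link_def antistar_def)

text \<open>Adding the boundary of the cone \<open>x * e\<close> to \<open>b\<close> cancels every simplex containing \<open>x\<close>;
  what remains is \<open>e\<close> plus the part of \<open>b\<close> off \<open>x\<close>.\<close>

lemma push_off_vertex:
  fixes b c e :: "'v list \<Rightarrow> 'f::field"
  assumes K: "simplicial_complex K" and x: "{x} \<in> K"
    and c: "c \<in> oriented_chains (antistar K x) i"
    and b: "b \<in> oriented_chains K (i + 1)" "boundary_map K b = c"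
    and e: "e \<in> oriented_chains (link K {x}) (i + 1)"
      "boundary_map (link K {x}) e = (\<lambda>ws. b (x # ws))"
  shows "c \<in> boundaries (antistar K x) i"
proof -
  let ?A = "antistar K x" and ?V = "\<Union>K"
  define b0 where "b0 = (\<lambda>xs. if x \<in> set xs then 0 else b xs)"
  define b' where "b' = (\<lambda>xs. b0 xs + e xs)"
  have V: "finite ?V" "x \<in> ?V" using finite_vertices[OF K] x by auto
  have "b0 \<in> oriented_chains ?A (i + 1)"
  proof (rule oriented_chainsI)
    fix xs assume "b0 xs \<noteq> 0"
    then show "distinct xs \<and> set xs \<in> ?A \<and> face_dim (set xs) = i + 1"
      using chain_support[OF b(1), of xs] by (auto simp: b0_def antistar_def split: if_splits)
  next
    fix xs y z ys
    show "b0 (xs @ y # z # ys) = - b0 (xs @ z # y # ys)"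
      using chain_swap[OF b(1), of xs y z ys] by (auto simp: b0_def)
  qed
  moreover have "e \<in> oriented_chains ?A (i + 1)"
    using e(1) by (rule chain_mono) (auto simp: link_def antistar_def)
  ultimately have b': "b' \<in> oriented_chains ?A (i + 1)"
    unfolding b'_def by (rule chain_add)
  have "boundary_map ?A b' ws = c ws" for ws
  proof (cases "x \<in> set ws")
    case True
    then have "b' (v # ws) = 0" for v
      using chain_support(2)[OF b', of "v # ws"] by (auto simp: antistar_def)
    moreover have "c ws = 0"
      using True chain_support(2)[OF c, of ws] by (auto simp: antistar_def)
    ultimately show ?thesis by (simp add: boundary_map_def)
  next
    case False
    have e_sum: "(\<Sum>v\<in>?V. e (v # ws)) = b (x # ws)"
    proof -
      have "\<Union>(link K {x}) \<subseteq> ?V" by (auto simp: link_def)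
      then show ?thesis using boundary_map_eq[OF e(1) V(1), of ws] e(2) by simp
    qed
    \<comment> \<open>Dropping the simplices through \<open>x\<close> loses exactly the term
      \<open>v = x\<close>, which \<open>e_sum\<close> restores.\<close>
    have "(\<Sum>v\<in>?V. b0 (v # ws)) = (\<Sum>v\<in>?V - {x}. b (v # ws))"
      using False V by (intro sum.mono_neutral_cong_right) (auto simp: b0_def)
    also have "\<dots> = c ws - b (x # ws)"
      using fun_cong[OF b(2), of ws] sum.remove[OF V, of "\<lambda>v. b (v # ws)"]
      by (simp add: boundary_map_def eq_diff_eq add.commute)
    finally have "(\<Sum>v\<in>?V. b' (v # ws)) = c ws"
      using e_sum by (simp add: b'_def sum.distrib)
    then show ?thesis
      using boundary_map_eq[OF b' V(1), of ws] by (auto simp: antistar_def)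
  qed
  then have "c = boundary_map ?A b'" by auto
  then show ?thesis unfolding boundaries_def using b' by blast
qed

text \<open>In degree \<open>m\<close> a cycle of the antistar is a top cycle of \<open>L\<close>
  vanishing around \<open>x\<close>, hence zero. In other degrees the obstruction to pushing a
  filling off \<open>x\<close> is a class in degree \<open>i\<close> of the link of
  \<open>x\<close>, which can be nonzero only for \<open>i = m - 1\<close>.\<close>

lemma antistar_acyclic:
  fixes F :: "'f::field itself" and L :: "'v set set"
  assumes L: "local_sphere F m L" and x: "{x} \<in> L"
  shows "acyclic_complex F (antistar L x)"
  unfolding acyclic_complex_def homology_vanishes_iff
proof (intro allI impI)
  fix i and c :: "'v list \<Rightarrow> 'f" assume cyc: "c \<in> cycles (antistar L x) i"
  note K = local_sphereD(1)[OF L]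
  note H = local_sphere_homology[OF L, unfolded has_homology_of_sphere_def]
  let ?A = "antistar L x" and ?V = "\<Union>L" and ?N = "link L {x}"
  note c = cycles_chain[OF cyc]
  have V: "finite ?V" "\<Union>?A \<subseteq> ?V" using finite_vertices[OF K] by (auto simp: antistar_def)
  have cL: "c \<in> oriented_chains L i" using c by (rule chain_mono) (auto simp: antistar_def)
  then have cycL: "c \<in> cycles L i"
    using cyclesI[OF cL V(1)] cycle_sum_zero[OF cyc V] by blast
  have c0: "c ws = 0" if "x \<in> set ws" for ws
    using chain_support(2)[OF c, of ws] that by (auto simp: antistar_def)
  show "c \<in> boundaries ?A i"
  proof (cases "i = int m")
    case True
    then have "c = (\<lambda>_. 0)" using top_cycle_zero[OF L _ x] cycL c0 by simp
    then show ?thesis by simp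
  next
    case False
    then have "c \<in> boundaries L i" using H cycL by (simp add: homology_vanishes_iff)
    then obtain b where b: "b \<in> oriented_chains L (i + 1)" "boundary_map L b = c"
      unfolding boundaries_def by blast
    \<comment> \<open>The chain \<open>b\<close> need not be a cycle, but its boundary
      \<open>c\<close> has no simplex through \<open>x\<close>.\<close>
    have bx: "(\<lambda>ws. b (x # ws)) \<in> cycles ?N i"
      using link_cycle[OF b(1) K, of x] b(2) c0 by simp
    have HN: "has_homology_of_sphere F (int m - 1) ?N"
      using local_sphereD(3)[OF L x] by (simp add: face_dim_def)
    show ?thesis
    proof (cases "i = int m - 1")
      case False
      then have "(\<lambda>ws. b (x # ws)) \<in> boundaries ?N i"
        using HN bx by (simp add: has_homology_of_sphere_def homology_vanishes_iff)
      then obtain e where "e \<in> oriented_chains ?N (i + 1)"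
        "boundary_map ?N e = (\<lambda>ws. b (x # ws))"
        unfolding boundaries_def by fastforce
      then show ?thesis using push_off_vertex[OF K x c b] by blast
    next
      case i: True
      \<comment> \<open>The fundamental cycle of \<open>L\<close> restricts to a generator of the homology of the link, so a
        multiple of it can be subtracted from \<open>b\<close> to kill the part of \<open>b\<close> around \<open>x\<close>.\<close>
      obtain z :: "'v list \<Rightarrow> 'f" where z: "z \<in> cycles L (int m)" "z \<notin> boundaries L (int m)"
        using H by (auto elim: homology_iso_fieldE)
      have zx: "(\<lambda>ws. z (x # ws)) \<in> cycles ?N i"
        using link_cycle[OF cycles_chain[OF z(1)] K, of x] z(1) i by (simp add: cycles_def)
      have "\<exists>ws. z (x # ws) \<noteq> 0"
        using top_cycle_zero[OF L z(1) x] z(2) by fastforce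
      then obtain us where us: "z (x # us) \<noteq> 0" by blast
      \<comment> \<open>The link has dimension at most \<open>m - 1 = i\<close>, so its cycles in
        degree \<open>i\<close> are exact multiples of \<open>g\<close>, not just up to
        boundaries.\<close>
      have bd: "f = (\<lambda>_. 0)" if "f \<in> boundaries ?N i" for f :: "'v list \<Rightarrow> 'f"
      proof (rule boundary_zero_top_dim[OF that])
        fix \<sigma> assume s: "\<sigma> \<in> ?N"
        then have "insert x \<sigma> \<in> L" "x \<notin> \<sigma>" "finite \<sigma>"
          using face_finite[OF K] by (auto simp: link_def)
        then show "face_dim \<sigma> \<le> i"
          using local_sphereD(2)[OF L, of "insert x \<sigma>"] i by (simp add: face_dim_def)
      qed
      have "homology_iso_field F ?N i" using HN i by (simp add: has_homology_of_sphere_def)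
      then obtain g :: "'v list \<Rightarrow> 'f" where
        g: "\<And>z'. z' \<in> cycles ?N i \<Longrightarrow> \<exists>a. (\<lambda>xs. z' xs - a * g xs) \<in> boundaries ?N i"
        by (rule homology_iso_fieldE) blast
      have g': "\<exists>a. \<forall>ws. z' ws = a * g ws" if z': "z' \<in> cycles ?N i" for z'
      proof -
        obtain a where "(\<lambda>xs. z' xs - a * g xs) \<in> boundaries ?N i" using g[OF z'] ..
        from fun_cong[OF bd[OF this]] show ?thesis by (intro exI[of _ a]) simp
      qed
      obtain a1 where a1: "\<And>ws. b (x # ws) = a1 * g ws" using g'[OF bx] by blast
      obtain a2 where a2: "\<And>ws. z (x # ws) = a2 * g ws" using g'[OF zx] by blast
      have "a2 \<noteq> 0" using us a2 by auto
      \<comment> \<open>Around \<open>x\<close>, \<open>b\<close> is \<open>a1 * g\<close> and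
        \<open>z\<close> is \<open>a2 * g\<close>, so this multiple of \<open>z\<close> cancels
        \<open>b\<close> there. As \<open>z\<close> is a cycle of degree \<open>m = i + 1\<close>,
        degree and boundary of \<open>b\<close> are kept, and the zero chain serves as the filling
        in the link.\<close>
      define b' where "b' = (\<lambda>xs. b xs - (a1 / a2) * z xs)"
      have "z \<in> oriented_chains L (i + 1)" using cycles_chain[OF z(1)] i by simp
      then have b': "b' \<in> oriented_chains L (i + 1)"
        unfolding b'_def by (rule chain_lincomb[OF b(1)])
      have "boundary_map L z = (\<lambda>_. 0)" using z(1) by (simp add: cycles_def)
      then have db': "boundary_map L b' = c"
        unfolding b'_def boundary_map_lincomb using b(2) by simp
      have "boundary_map ?N (\<lambda>_. 0) = (\<lambda>ws. b' (x # ws))"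
        using \<open>a2 \<noteq> 0\<close> by (simp add: b'_def a1 a2)
      then show ?thesis using push_off_vertex[OF K x c b' db' zero_chain] by blast
    qed
  qed
qed

text \<open>This ensures that the cone over the antistar gains a dimension. Otherwise a top cycle
  \<open>z\<close> would live on simplices through \<open>x\<close>; its boundary at
  \<open>ws\<close> off \<open>x\<close> is then just \<open>z (x # ws)\<close>, so \<open>z\<close>
  vanishes around \<open>x\<close> and hence everywhere.\<close>

lemma facet_avoiding_vertex:
  fixes F :: "'f::field itself" and L :: "'v set set"
  assumes L: "local_sphere F m L" and x: "{x} \<in> L"
  obtains \<sigma> where "\<sigma> \<in> antistar L x" "face_dim \<sigma> = int m"
proof (rule ccontr)
  assume no: "\<not> thesis"
  note K = local_sphereD(1)[OF L]
  have "homology_iso_field F L (int m)"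
    using local_sphere_homology[OF L] by (simp add: has_homology_of_sphere_def)
  then obtain z :: "'v list \<Rightarrow> 'f" where z: "z \<in> cycles L (int m)" "z \<notin> boundaries L (int m)"
    by (rule homology_iso_fieldE) blast
  note zc = cycles_chain[OF z(1)]
  have off: "z ws = 0" if "x \<notin> set ws" for ws
    using chain_support[OF zc, of ws] that no \<open>\<And>\<sigma>. \<lbrakk>\<sigma> \<in> antistar L x; face_dim \<sigma> = int m\<rbrakk> \<Longrightarrow> thesis\<close>
    by (auto simp: antistar_def)
  have "z (x # ws) = 0" for ws
  proof (cases "x \<in> set ws")
    case True
    then show ?thesis using chain_support(1)[OF zc, of "x # ws"] by auto
  next
    case False
    have xV: "x \<in> \<Union>L" using x by blast
    have "(\<Sum>v\<in>\<Union>L. z (v # ws)) = (\<Sum>v\<in>\<Union>L. if v = x then z (x # ws) else 0)"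
      using off False by (intro sum.cong) auto
    then show ?thesis
      using cycle_sum_zero[OF z(1) finite_vertices[OF K] order_refl, of ws]
        finite_vertices[OF K] xV by simp
  qed
  then have "z = (\<lambda>_. 0)" using top_cycle_zero[OF L z(1) x] by blast
  then show False using z(2) by simp
qed

section \<open>The cone over the antistar\<close>

text \<open>When no face of \<open>K\<close> contains \<open>x\<close>, this is the join of
  \<open>x\<close> with \<open>K\<close>, described uniformly for faces with and without the
  apex.\<close>

definition cone :: "'v \<Rightarrow> 'v set set \<Rightarrow> 'v set set" where
  "cone x K = {\<sigma>. \<sigma> - {x} \<in> K}"

lemma cone_complex:
  assumes K: "simplicial_complex K"
  shows "simplicial_complex (cone x K)"
  unfolding simplicial_complex_def
proof (intro conjI ballI allI impI)
  have "cone x K \<subseteq> K \<union> insert x ` K"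
  proof
    fix \<sigma> assume "\<sigma> \<in> cone x K"
    then have "\<sigma> - {x} \<in> K" "\<sigma> = \<sigma> - {x} \<or> \<sigma> = insert x (\<sigma> - {x})"
      by (auto simp: cone_def)
    then show "\<sigma> \<in> K \<union> insert x ` K" by (metis UnI1 UnI2 imageI)
  qed
  moreover have "finite K" using K by (simp add: simplicial_complex_def)
  ultimately show "finite (cone x K)" by (meson finite_UnI finite_imageI finite_subset)
  show "{} \<in> cone x K" using K by (simp add: cone_def simplicial_complex_def)
  fix \<sigma> assume s: "\<sigma> \<in> cone x K"
  then show "finite \<sigma>" using face_finite[OF K, of "\<sigma> - {x}"] by (simp add: cone_def)
  fix \<tau> assume "\<tau> \<subseteq> \<sigma>"
  then show "\<tau> \<in> cone x K"
    using s face_subset[OF K, of "\<sigma> - {x}" "\<tau> - {x}"] by (auto simp: cone_def)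
qed

lemma insert_mem_cone: "\<sigma> \<in> cone x K \<Longrightarrow> insert x \<sigma> \<in> cone x K"
  by (simp add: cone_def)

lemma link_cone_acyclic:
  assumes K: "simplicial_complex K" and s: "\<sigma> \<in> cone x K" and x: "x \<notin> \<sigma>"
  shows "acyclic_complex F (link (cone x K) \<sigma>)"
proof (rule cone_acyclic)
  show "simplicial_complex (link (cone x K) \<sigma>)"
    using link_complex[OF cone_complex[OF K] s] .
  show "insert x \<tau> \<in> link (cone x K) \<sigma>" if "\<tau> \<in> link (cone x K) \<sigma>" for \<tau>
    using that x insert_mem_cone[of \<tau> x K] insert_mem_cone[of "\<tau> \<union> \<sigma>" x K]
    by (simp add: link_def)
qed

lemma link_cone_apex:
  assumes "\<And>\<tau>. \<tau> \<in> K \<Longrightarrow> x \<notin> \<tau>" and x: "x \<in> \<sigma>"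
  shows "link (cone x K) \<sigma> = link K (\<sigma> - {x})"
proof -
  have "\<tau> \<in> link (cone x K) \<sigma> \<longleftrightarrow> \<tau> \<in> link K (\<sigma> - {x})" for \<tau>
  proof (cases "x \<in> \<tau>")
    case True
    then show ?thesis using assms by (auto simp: link_def)
  next
    case False
    then have "(\<tau> \<union> \<sigma>) - {x} = \<tau> \<union> (\<sigma> - {x})" "\<tau> - {x} = \<tau>" "\<tau> \<inter> \<sigma> = \<tau> \<inter> (\<sigma> - {x})" by auto
    then show ?thesis by (simp add: link_def cone_def)
  qed
  then show ?thesis by blast
qed

lemma homology_sphere_local:
  assumes "homology_sphere F (int d) S"
  shows "local_sphere F d S"
proof -
  have "finite S" "complex_dim S = int d"
    using assms by (auto simp: homology_sphere_def simplicial_complex_def)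
  then have "face_dim \<sigma> \<le> int d" if "\<sigma> \<in> S" for \<sigma>
    using that Max_ge[of "face_dim ` S" "face_dim \<sigma>"] by (simp add: complex_dim_def)
  then show ?thesis using assms by (auto simp: homology_sphere_def local_sphere_def)
qed

text \<open>As \<open>d\<close> is a natural number, a face of dimension \<open>d\<close> is
  nonempty; the (-1)-sphere is excluded.\<close>

lemma homology_sphere_vertex:
  assumes "homology_sphere F (int d) S"
  obtains x where "{x} \<in> S"
proof -
  have K: "simplicial_complex S" and dim: "complex_dim S = int d"
    using assms by (auto simp: homology_sphere_def)
  have "Max (face_dim ` S) \<in> face_dim ` S"
    using K by (intro Max_in) (auto simp: simplicial_complex_def)
  then obtain \<sigma> where s: "\<sigma> \<in> S" "face_dim \<sigma> = int d"
    using dim by (auto simp: complex_dim_def)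
  then have "\<sigma> \<noteq> {}" by (auto simp: face_dim_def)
  then obtain x where "x \<in> \<sigma>" by blast
  then show ?thesis using face_subset[OF K s(1), of "{x}"] that by blast
qed

section \<open>The cone over the antistar as a stacked ball\<close>

context
  fixes F :: "'f::field itself" and S :: "'v set set" and d :: nat and x :: 'v
  assumes sphere: "homology_sphere F (int d) S" and vertex: "{x} \<in> S"
begin

abbreviation "cone_ball \<equiv> cone x (antistar S x)"

lemmas local_S = homology_sphere_local[OF sphere]
lemmas complex_S = local_sphereD(1)[OF local_S]
lemmas complex_A = antistar_complex[OF complex_S, of x]

text \<open>One dichotomy gives both the boundary and the ball condition. Faces off \<open>x\<close>
  lie in \<open>S\<close> and have cones as links. For \<open>x \<in> \<sigma>\<close> the link is
  the antistar of \<open>x\<close> in \<open>link S \<tau>\<close>; whether \<open>x\<close> is a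
  vertex of \<open>link S \<tau>\<close> is decided by \<open>\<sigma> \<in> S\<close>.\<close>

lemma link_cone_ball:
  assumes s: "\<sigma> \<in> cone_ball"
  shows "\<sigma> \<in> S \<and> acyclic_complex F (link cone_ball \<sigma>) \<or>
    \<sigma> \<notin> S \<and> \<sigma> \<noteq> {} \<and> has_homology_of_sphere F (int d - face_dim \<sigma>) (link cone_ball \<sigma>)"
proof (cases "x \<in> \<sigma>")
  case False
  then show ?thesis
    using link_cone_acyclic[OF complex_A s] s by (auto simp: cone_def antistar_def)
next
  case True
  define \<tau> where "\<tau> = \<sigma> - {x}"
  have t: "\<tau> \<in> S" "x \<notin> \<tau>" "insert x \<tau> = \<sigma>"
    using s True by (auto simp: cone_def antistar_def \<tau>_def)
  have fin: "finite \<tau>" using face_finite[OF complex_S t(1)] .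
  have card: "card \<sigma> = Suc (card \<tau>)" using t fin by force
  have "link cone_ball \<sigma> = link (antistar S x) \<tau>"
    unfolding \<tau>_def using True by (intro link_cone_apex) (auto simp: antistar_def)
  also have "\<dots> = antistar (link S \<tau>) x"
    using link_antistar[OF t(2)] .
  finally have lk: "link cone_ball \<sigma> = antistar (link S \<tau>) x" .
  show ?thesis
  proof (cases "\<sigma> \<in> S")
    case True
    have "face_dim \<sigma> \<le> int d" using local_sphereD(2)[OF local_S True] .
    \<comment> \<open>\<open>card \<tau>\<close> is the dimension of \<open>\<sigma>\<close>, so the
      natural subtraction is exact.\<close>
    then have "d = (d - card \<tau>) + card \<tau>" using card by (simp add: face_dim_def)
    then have "local_sphere F (d - card \<tau>) (link S \<tau>)"
      using local_sphere_link[OF local_S t(1)] by blast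
    moreover have "{x} \<in> link S \<tau>" using t True vertex by (simp add: link_def)
    ultimately have "acyclic_complex F (link cone_ball \<sigma>)"
      unfolding lk by (rule antistar_acyclic)
    then show ?thesis using True by blast
  next
    case False
    \<comment> \<open>A face of this link through \<open>x\<close> would put
      \<open>\<sigma> \<subseteq> \<rho> \<union> \<tau>\<close> into \<open>S\<close>.\<close>
    have "x \<notin> \<rho>" if "\<rho> \<in> link S \<tau>" for \<rho>
      using that False t face_subset[OF complex_S, of "\<rho> \<union> \<tau>" \<sigma>] by (auto simp: link_def)
    then have "antistar (link S \<tau>) x = link S \<tau>" by (auto simp: antistar_def)
    then have "link cone_ball \<sigma> = link S \<tau>" using lk by simp
    moreover have "has_homology_of_sphere F (int d - face_dim \<tau> - 1) (link S \<tau>)"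
      using local_sphereD(3)[OF local_S t(1)] .
    ultimately show ?thesis using False t card by (auto simp: face_dim_def)
  qed
qed

lemma sphere_subset_cone_ball: "S \<subseteq> cone_ball"
proof
  fix \<sigma> assume "\<sigma> \<in> S"
  then have "\<sigma> - {x} \<in> S" using face_subset[OF complex_S] by blast
  then show "\<sigma> \<in> cone_ball" by (simp add: cone_def antistar_def)
qed

text \<open>A complex with the homology of a sphere is never acyclic, so the two alternatives for
  links separate \<open>S\<close> from the rest.\<close>

lemma boundary_cone_ball: "ball_boundary F cone_ball = S"
  unfolding ball_boundary_def
  using sphere_subset_cone_ball link_cone_ball sphere_not_acyclic by blast

lemma dim_cone_ball: "complex_dim cone_ball = int d + 1"
  unfolding complex_dim_def
proof (rule Max_eqI)
  note B = cone_complex[OF complex_A, of x]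
  show "finite (face_dim ` cone_ball)" using B by (simp add: simplicial_complex_def)
  fix k assume "k \<in> face_dim ` cone_ball"
  then obtain \<sigma> where s: "\<sigma> \<in> cone_ball" "k = face_dim \<sigma>" by blast
  then have "face_dim (\<sigma> - {x}) \<le> int d"
    using local_sphereD(2)[OF local_S] by (simp add: cone_def antistar_def)
  moreover have "card \<sigma> \<le> Suc (card (\<sigma> - {x}))"
    by (metis card_Suc_Diff1 Diff_empty Diff_insert0 face_finite[OF B s(1)] le_SucI order_refl)
  ultimately show "k \<le> int d + 1" using s by (simp add: face_dim_def)
next
  obtain \<sigma> where s: "\<sigma> \<in> antistar S x" "face_dim \<sigma> = int d"
    using facet_avoiding_vertex[OF local_S vertex] .
  then have "insert x \<sigma> \<in> cone_ball" "x \<notin> \<sigma>" "finite \<sigma>"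
    using face_finite[OF complex_A] by (auto simp: cone_def antistar_def)
  then show "int d + 1 \<in> face_dim ` cone_ball"
    using s by (intro image_eqI[of _ _ "insert x \<sigma>"]) (auto simp: face_dim_def)
qed

lemma stacked_cone_ball: "stacked_ball F d (int d + 1) cone_ball"
  unfolding stacked_ball_def homology_ball_def boundary_cone_ball
proof (intro conjI ballI impI)
  show "simplicial_complex cone_ball" using cone_complex[OF complex_A] .
  show "complex_dim cone_ball = int d + 1" by (rule dim_cone_ball)
  show "acyclic_complex F cone_ball"
    using cone_acyclic[OF cone_complex[OF complex_A] insert_mem_cone] .
  show "homology_sphere F (int d + 1 - 1) S" using sphere by simp
  show "has_homology_of_sphere F (int d + 1 - face_dim \<sigma> - 1) (link cone_ball \<sigma>) \<or>
      acyclic_complex F (link cone_ball \<sigma>)" if "\<sigma> \<in> cone_ball" "\<sigma> \<noteq> {}" for \<sigma>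
    using link_cone_ball[OF that(1)] by auto
  \<comment> \<open>For \<open>k = d\<close> in dimension \<open>d + 1\<close> only the empty face
    and the vertices are concerned. The vertices of the cone are \<open>x\<close> and those of the
    antistar, all in \<open>S\<close>.\<close>
  fix \<sigma> assume s: "\<sigma> \<in> cone_ball" and "int d + 1 - face_dim \<sigma> \<ge> int d + 1"
  then have "card \<sigma> \<le> 1" by (simp add: face_dim_def)
  moreover have "finite \<sigma>" using face_finite[OF cone_complex[OF complex_A] s] .
  ultimately have "\<sigma> = {} \<or> (\<exists>v. \<sigma> = {v})"
    by (metis card_0_eq card_1_singletonE le_SucE le_zero_eq One_nat_def)
  then show "\<sigma> \<in> S"
    using s vertex by (auto simp: cone_def antistar_def insert_Diff_if split: if_splits)
qed

end

theorem theorem2p6: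
  fixes F :: "'f::field itself" and S :: "'v set set" and d :: nat
  assumes "homology_sphere F (int d) S"
  shows "stacked_sphere F d (int d) S"
proof -
  obtain x where x: "{x} \<in> S" using homology_sphere_vertex[OF assms] .
  show ?thesis
    unfolding stacked_sphere_def
    using assms stacked_cone_ball[OF assms x] boundary_cone_ball[OF assms x] by (intro conjI exI)
qed

end
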